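(* Let $\emptyset\neq L\subseteq M\subset N\subseteq V$, and for $Z\subseteq M$ put $\delta_{Z}(x_Z)=\lambda_{Z}^{M}(x_Z)-\lambda_{Z}^{N}(x_Z)$. Then each of the following conditions is equivalent to collapsibility of the table $\mathfrak{X}_{N}$ over $N\setminus M$ into $\mathfrak{X}_{M}$ with respect to $\lambda_{L}^{N}$: (i) $\delta_{L}(x_{L})=0$ for all $x_{L}\in\mathfrak{X}_{L}$; (ii) $\tilde d_{L}^{(M)}(x_{L})=\sum_{Z\subset L}\delta_{Z}(x_{Z})$ for all $x_{L}\in\mathfrak{X}_{L}$, where the sum is over all proper subsets $Z$ of $L$ (including $\emptyset$) and $x_Z$ is the restriction of $x_L$ to $Z$; (iii) $\sum_{Z\subseteq L}(-1)^{|L\setminus Z|}\,\tilde d_{Z}^{(M)}(x_{Z})=0$ for all $x_L\in\mathfrak{X}_L$, where $x_Z$ is the restriction of $x_L$ to $Z$.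
   Context: $V$ is a finite index set; for $v\in V$, $X_v$ is a categorical variable with finite level set $\mathfrak{X}_v=\{0,1,\dots,|\mathfrak{X}_v|-1\}$. For $A\subseteq V$, $\mathfrak{X}_A=\prod_{v\in A}\mathfrak{X}_v$ (with $|\mathfrak{X}_\emptyset|=1$); for $x\in\mathfrak{X}_A$ and $B\subseteq A$, $x_B$ is the restriction of $x$ to $B$. The joint distribution $p=p_V$ of $(X_v)_{v\in V}$ on $\mathfrak{X}_V$ is strictly positive, and $p_A$ denotes its marginal on $\mathfrak{X}_A$. The symbol $\subset$ denotes strict inclusion. For $L\subseteq M\subseteq V$ and $x_L\in\mathfrak{X}_L$, define $$\nu_L^M(x_L)=\frac{1}{|\mathfrak{X}_{M\setminus L}|}\sum_{j_M\in\mathfrak{X}_M:\,j_L=x_L}\log p_M(j_M),\qquad \lambda_L^M(x_L)=\sum_{L'\subseteq L}(-1)^{|L\setminus L'|}\nu_{L'}^M(x_{L'}).$$ $\lambda_L^M$ is called a marginal log-linear (MLL) parameter. For $\emptyset\ne L\subseteq M\subset N\subseteq V$, the table $\mathfrak{X}_N$ is collapsible over $N\setminus M$ into $\mathfrak{X}_M$ with respect to $\lambda_L^N$ if $\lambda_L^M(x_L)=\lambda_L^N(x_L)$ for all $x_L\in\mathfrak{X}_L$. For $M\subset N$ define $d^{(M)}(x_M)=\log p_M(x_M)-\nu_M^N(x_M)$ for $x_M\in\mathfrak{X}_M$, and for $Z\subseteq M$, $$\tilde d_Z^{(M)}(x_Z)=\frac{1}{|\mathfrak{X}_{M\setminus Z}|}\sum_{j_M\in\mathfrak{X}_M:\,j_Z=x_Z}d^{(M)}(j_M).$$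 *)

theory Defs
  imports "HOL-Probability.Probability"
begin

text \<open>Variables are indexed by elements of type \<open>'v\<close>, and the variable with index \<open>v\<close> has the
  level set \<open>{0, \<dots>, r v - 1}\<close>. A cell of the table over \<open>A\<close> is an extensional function
  (\<open>undefined\<close> outside \<open>A\<close>), so the table over the empty set has exactly one cell, and the
  restriction \<open>x\<^sub>B\<close> of a cell \<open>x\<close> is \<open>restrict x B\<close>.\<close>

definition table :: "('v \<Rightarrow> nat) \<Rightarrow> 'v set \<Rightarrow> ('v \<Rightarrow> nat) set" where
  "table r A = (\<Pi>\<^sub>E v\<in>A. {0..<r v})"

definition marginal :: "('v \<Rightarrow> nat) pmf \<Rightarrow> 'v set \<Rightarrow> ('v \<Rightarrow> nat) pmf" where
  "marginal p A = map_pmf (\<lambda>x. restrict x A) p"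

text \<open>In all definitions below, the superscript set(s) of the mathematical notation come before
  the subscript: \<open>nu r p M L\<close> is \<open>\<nu>\<close> with superscript \<open>M\<close> and subscript \<open>L\<close>, and likewise for
  \<open>mll\<close> (written \<open>\<lambda>\<close>).\<close>

definition nu :: "('v \<Rightarrow> nat) \<Rightarrow> ('v \<Rightarrow> nat) pmf \<Rightarrow> 'v set \<Rightarrow> 'v set \<Rightarrow> ('v \<Rightarrow> nat) \<Rightarrow> real" where
  "nu r p M L x =
     1 / real (card (table r (M - L))) *
     (\<Sum>j\<in>{j \<in> table r M. restrict j L = x}. ln (pmf (marginal p M) j))"

definition mll :: "('v \<Rightarrow> nat) \<Rightarrow> ('v \<Rightarrow> nat) pmf \<Rightarrow> 'v set \<Rightarrow> 'v set \<Rightarrow> ('v \<Rightarrow> nat) \<Rightarrow> real" where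
  "mll r p M L x = (\<Sum>L'\<in>Pow L. (- 1) ^ card (L - L') * nu r p M L' (restrict x L'))"

text \<open>\<open>collapsible r p N M L\<close>: the table over \<open>N\<close> is collapsible over \<open>N - M\<close> into the table over
  \<open>M\<close> with respect to the parameter \<open>\<lambda>\<close> with superscript \<open>N\<close> and subscript \<open>L\<close>.\<close>

definition collapsible ::
    "('v \<Rightarrow> nat) \<Rightarrow> ('v \<Rightarrow> nat) pmf \<Rightarrow> 'v set \<Rightarrow> 'v set \<Rightarrow> 'v set \<Rightarrow> bool" where
  "collapsible r p N M L \<longleftrightarrow> (\<forall>x\<in>table r L. mll r p M L x = mll r p N L x)"

text \<open>The quantities \<open>d\<close>, \<open>d\<close> with a tilde, and \<open>\<delta>\<close> all depend on both \<open>M\<close> and \<open>N\<close>, although the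
  mathematical notation suppresses \<open>N\<close> (and, for \<open>\<delta>\<close>, also \<open>M\<close>).\<close>

definition dd :: "('v \<Rightarrow> nat) \<Rightarrow> ('v \<Rightarrow> nat) pmf \<Rightarrow> 'v set \<Rightarrow> 'v set \<Rightarrow> ('v \<Rightarrow> nat) \<Rightarrow> real" where
  "dd r p N M x = ln (pmf (marginal p M) x) - nu r p N M x"

definition dtilde ::
    "('v \<Rightarrow> nat) \<Rightarrow> ('v \<Rightarrow> nat) pmf \<Rightarrow> 'v set \<Rightarrow> 'v set \<Rightarrow> 'v set \<Rightarrow> ('v \<Rightarrow> nat) \<Rightarrow> real" where
  "dtilde r p N M Z x =
     1 / real (card (table r (M - Z))) *
     (\<Sum>j\<in>{j \<in> table r M. restrict j Z = x}. dd r p N M j)"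

definition delta ::
    "('v \<Rightarrow> nat) \<Rightarrow> ('v \<Rightarrow> nat) pmf \<Rightarrow> 'v set \<Rightarrow> 'v set \<Rightarrow> 'v set \<Rightarrow> ('v \<Rightarrow> nat) \<Rightarrow> real" where
  "delta r p N M Z x = mll r p M Z x - mll r p N Z x"

end

theory Submission
  imports Defs
begin

text \<open>Averaging the log-probabilities of the cells over \<open>N\<close> first down to \<open>M\<close> and then down to
  \<open>Z \<subseteq> M\<close> is the same as averaging them directly down to \<open>Z\<close> (\<open>average_nu\<close>). As \<open>dtilde\<close>
  averages the difference of two functions on the cells over \<open>M\<close>, whose averages are \<open>nu\<close> with
  superscripts \<open>M\<close> and \<open>N\<close>, it follows that \<open>dtilde\<close> is the difference of these two \<open>nu\<close>s
  (\<open>dtilde_eq_nu_diff\<close>). Since \<open>mll\<close> is the alternating sum of \<open>nu\<close> over the subsets of its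
  index set, the parameter difference \<open>delta\<close> is the alternating sum of \<open>dtilde\<close>
  (\<open>delta_eq_alternating_sum_dtilde\<close>), which turns (i) into (iii). Moebius inversion on the subset
  lattice turns this around: \<open>dtilde\<close> at \<open>L\<close> is the sum of \<open>delta\<close> over all subsets of \<open>L\<close>
  (\<open>dtilde_eq_sum_delta\<close>). Splitting off the summand at \<open>L\<close> itself shows that (ii) says precisely
  that this summand vanishes. Condition (i) is the definition of collapsibility.\<close>

text \<open>The two layers of signs are separated by writing \<open>(- 1) ^ card (T - U)\<close> as
  \<open>(- 1) ^ card T * (- 1) ^ card U\<close>, after which this is the self-inverse form of
  inclusion-exclusion.\<close>

lemma sum_Pow_alternating_sum:
  fixes f :: "'a set \<Rightarrow> 'b::comm_ring_1"
  assumes "finite S"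
  shows "(\<Sum>T\<in>Pow S. \<Sum>U\<in>Pow T. (- 1) ^ card (T - U) * f U) = f S"
proof -
  have sign: "(- 1 :: 'b) ^ card (T - U) = (- 1) ^ card T * (- 1) ^ card U"
    if "finite T" "U \<subseteq> T" for T U :: "'a set"
  proof -
    have "card (T - U) = card T - card U"
      using that by (simp add: card_Diff_subset finite_subset)
    then show ?thesis
      using that
      by (simp add: card_mono neg_one_power_add_eq_neg_one_power_diff flip: power_add)
  qed
  have "f S = (\<Sum>T\<in>Pow S. (- 1) ^ card T * (\<Sum>U\<in>Pow T. (- 1) ^ card U * f U))"
    by (rule inclusion_exclusion_symmetric) (use assms in simp_all)
  also have "\<dots> = (\<Sum>T\<in>Pow S. \<Sum>U\<in>Pow T. (- 1) ^ card (T - U) * f U)"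
  proof (rule sum.cong[OF refl])
    fix T assume "T \<in> Pow S"
    then have "finite T"
      using assms finite_subset by auto
    then show "(- 1) ^ card T * (\<Sum>U\<in>Pow T. (- 1) ^ card U * f U)
        = (\<Sum>U\<in>Pow T. (- 1) ^ card (T - U) * f U)"
      by (simp add: sum_distrib_left sign mult.assoc)
  qed
  finally show ?thesis ..
qed

lemma finite_table: "finite A \<Longrightarrow> finite (table r A)"
  by (simp add: table_def finite_PiE)

lemma restrict_in_table: "x \<in> table r A \<Longrightarrow> B \<subseteq> A \<Longrightarrow> restrict x B \<in> table r B"
  by (auto simp: table_def)

lemma card_table: "finite A \<Longrightarrow> card (table r A) = (\<Prod>v\<in>A. r v)"
  by (simp add: table_def card_PiE)

lemma card_table_Diff_mult:
  assumes "finite N" "Z \<subseteq> M" "M \<subseteq> N"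
  shows "card (table r (N - Z)) = card (table r (M - Z)) * card (table r (N - M))"
proof -
  have "N - Z = (M - Z) \<union> (N - M)" "finite (M - Z)" "finite (N - M)"
    using assms by (auto intro: finite_subset)
  then show ?thesis
    by (auto simp: card_table intro!: prod.union_disjoint)
qed

text \<open>The cells over \<open>N\<close> that restrict to \<open>x\<close> are partitioned by their restrictions to \<open>M\<close>.\<close>

lemma sum_fibre_table:
  assumes "finite N" "Z \<subseteq> M" "M \<subseteq> N"
  shows "(\<Sum>j\<in>{j \<in> table r M. restrict j Z = x}. \<Sum>k\<in>{k \<in> table r N. restrict k M = j}. h k)
    = (\<Sum>k\<in>{k \<in> table r N. restrict k Z = x}. h k)"
proof -
  let ?S = "{k \<in> table r N. restrict k Z = x}" and ?T = "{j \<in> table r M. restrict j Z = x}"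
  have fin: "finite ?S" "finite ?T"
    using assms by (auto intro: finite_table finite_subset)
  have restr: "restrict (restrict k M) Z = restrict k Z" for k :: "'a \<Rightarrow> nat"
    using assms by (simp add: Int_absorb1)
  have "(\<lambda>k. restrict k M) ` ?S \<subseteq> ?T"
    using assms by (auto simp: Int_absorb1 intro: restrict_in_table)
  then have "(\<Sum>j\<in>?T. sum h {k. k \<in> ?S \<and> restrict k M = j}) = sum h ?S"
    by (rule sum.group[OF fin])
  moreover have "{k. k \<in> ?S \<and> restrict k M = j} = {k \<in> table r N. restrict k M = j}"
    if "j \<in> ?T" for j
    using that restr by auto
  ultimately show ?thesis
    by simp
qed

text \<open>Both normalisations are uniform over fibres of constant size, and these sizes multiply
  because \<open>N - Z\<close> is the disjoint union of \<open>M - Z\<close> and \<open>N - M\<close>.\<close>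

lemma average_nu:
  assumes "finite N" "Z \<subseteq> M" "M \<subseteq> N"
  shows "1 / real (card (table r (M - Z))) * (\<Sum>j\<in>{j \<in> table r M. restrict j Z = x}. nu r p N M j)
    = nu r p N Z x"
  unfolding nu_def sum_distrib_left[symmetric] sum_fibre_table[OF assms]
  by (simp add: card_table_Diff_mult[OF assms])

lemma dtilde_eq_nu_diff:
  assumes "finite N" "Z \<subseteq> M" "M \<subseteq> N"
  shows "dtilde r p N M Z x = nu r p M Z x - nu r p N Z x"
  unfolding dtilde_def dd_def sum_subtractf right_diff_distrib average_nu[OF assms]
  by (simp add: nu_def)

lemma delta_eq_alternating_sum_dtilde:
  assumes "finite N" "L \<subseteq> M" "M \<subseteq> N"
  shows "delta r p N M L x = (\<Sum>Z\<in>Pow L. (- 1) ^ card (L - Z) * dtilde r p N M Z (restrict x Z))"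
proof -
  have "dtilde r p N M Z (restrict x Z) = nu r p M Z (restrict x Z) - nu r p N Z (restrict x Z)"
    if "Z \<in> Pow L" for Z
    using that assms by (intro dtilde_eq_nu_diff) auto
  then show ?thesis
    by (simp add: delta_def mll_def right_diff_distrib sum_subtractf)
qed

text \<open>For a fixed cell \<open>x\<close>, both \<open>dtilde\<close> and \<open>delta\<close> at the restrictions of \<open>x\<close> are functions of
  the index set alone, so that Moebius inversion applies to the alternating sum above.\<close>

lemma dtilde_eq_sum_delta:
  assumes "finite N" "L \<subseteq> M" "M \<subseteq> N" "x \<in> table r L"
  shows "dtilde r p N M L x = (\<Sum>Z\<in>Pow L. delta r p N M Z (restrict x Z))"
proof -
  have "finite L"
    using assms by (meson finite_subset)
  have "restrict x L = x"
    using assms(4) by (auto simp: table_def PiE_def extensional_restrict)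
  then have "dtilde r p N M L x = dtilde r p N M L (restrict x L)"
    by simp
  also have "\<dots> = (\<Sum>Z\<in>Pow L. \<Sum>U\<in>Pow Z. (- 1) ^ card (Z - U) * dtilde r p N M U (restrict x U))"
    by (rule sum_Pow_alternating_sum[OF \<open>finite L\<close>, symmetric])
  also have "\<dots> = (\<Sum>Z\<in>Pow L. delta r p N M Z (restrict x Z))"
  proof (rule sum.cong[OF refl])
    fix Z assume "Z \<in> Pow L"
    then have "Z \<subseteq> M"
      using assms by auto
    have "restrict (restrict x Z) U = restrict x U" if "U \<in> Pow Z" for U
      using that by (simp add: Int_absorb1)
    then show "(\<Sum>U\<in>Pow Z. (- 1) ^ card (Z - U) * dtilde r p N M U (restrict x U))
        = delta r p N M Z (restrict x Z)"
      unfolding delta_eq_alternating_sum_dtilde[OF assms(1) \<open>Z \<subseteq> M\<close> assms(3)]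
      by (intro sum.cong) auto
  qed
  finally show ?thesis .
qed

lemma dtilde_eq_delta_plus_sum_proper:
  assumes "finite N" "L \<subseteq> M" "M \<subseteq> N" "x \<in> table r L"
  shows "dtilde r p N M L x
    = delta r p N M L x + (\<Sum>Z\<in>{Z. Z \<subset> L}. delta r p N M Z (restrict x Z))"
proof -
  have "finite L"
    using assms by (meson finite_subset)
  have "Pow L = insert L {Z. Z \<subset> L}" "finite {Z. Z \<subset> L}"
    using finite_Pow_iff[of L] \<open>finite L\<close> by (auto intro: finite_subset[of _ "Pow L"])
  moreover have "restrict x L = x"
    using assms(4) by (auto simp: table_def PiE_def extensional_restrict)
  ultimately show ?thesis
    by (simp add: dtilde_eq_sum_delta[OF assms])
qed

theorem theorem3p1:
  fixes V L M N :: "'v set"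
    and r :: "'v \<Rightarrow> nat"
    and p :: "('v \<Rightarrow> nat) pmf"
  assumes finite_V: "finite V"
    and levels: "\<forall>v\<in>V. 0 < r v"
    and strictly_positive: "set_pmf p = table r V"
    and sets: "L \<noteq> {}" "L \<subseteq> M" "M \<subset> N" "N \<subseteq> V"
  shows "(collapsible r p N M L \<longleftrightarrow>
            (\<forall>x\<in>table r L. delta r p N M L x = 0)) \<and>
         (collapsible r p N M L \<longleftrightarrow>
            (\<forall>x\<in>table r L.
               dtilde r p N M L x = (\<Sum>Z\<in>{Z. Z \<subset> L}. delta r p N M Z (restrict x Z)))) \<and>
         (collapsible r p N M L \<longleftrightarrow>
            (\<forall>x\<in>table r L.
               (\<Sum>Z\<in>Pow L. (- 1) ^ card (L - Z) * dtilde r p N M Z (restrict x Z)) = 0))"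
proof -
  have N: "finite N" "M \<subseteq> N"
    using finite_V sets by (auto intro: finite_subset)
  have i: "collapsible r p N M L \<longleftrightarrow> (\<forall>x\<in>table r L. delta r p N M L x = 0)"
    by (simp add: collapsible_def delta_def)
  show ?thesis
    unfolding i delta_eq_alternating_sum_dtilde[OF N(1) sets(2) N(2), symmetric]
    using dtilde_eq_delta_plus_sum_proper[OF N(1) sets(2) N(2)] by auto
qed

end
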